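(* For all integers $m\ge 2$ and $n\ge 1$, $$\operatorname{Vol}(\mathcal{P}_{m,n}\cap \mathcal{D}_{m,n})=\int_{[0,1]^m} f_m(y)^n\,dy ,$$ where, for $y\in[0,1]^m$, $$f_m(y):=\frac{1}{(m-1)!}\sum_{S\subset \{1,\dots,m\}}(-1)^{|S|}\Bigl(1-\sum_{i\in S}y_i\Bigr)_+^{m-1}.$$ In particular, $\operatorname{Vol}(\mathcal{P}_{2,n}\cap \mathcal{D}_{2,n})=\dfrac{1}{(n+1)(n+2)}$ for all $n\ge1$.
   Context: Let $m\ge2$, $n\ge1$ be integers, $M=\{1,\dots,m\}$, $N=\{1,\dots,n\}$. The set $\mathcal{P}_{m,n}$ (strong relaxation) consists of all $(x,y)\in\mathbb{R}^{m\times n}\times\mathbb{R}^m$ with $0\le x_{ij}\le y_i$ for all $(i,j)\in M\times N$ and $y_i\le 1$ for all $i\in M$. The demand constraints define $\mathcal{D}_{m,n}=\{(x,y)\in\mathbb{R}^{m\times n}\times\mathbb{R}^m:\ \sum_{i\in M}x_{ij}=1\ \ \forall j\in N\}$, an affine subspace of dimension $d=(m-1)n+m$. Let $\pi$ be the coordinate projection that deletes the variables $x_{mj}$, $j\in N$; it restricts to an affine bijection $\mathcal{D}_{m,n}\to\mathbb{R}^d$. For $K\subset\mathcal{D}_{m,n}$, $\operatorname{Vol}(K)$ denotes the $d$-dimensional Lebesgue measure of $\pi(K)$. For $a\in\mathbb{R}$, $a_+:=\max\{a,0\}$. The symbol $\subset$ means any subset, not necessarily proper (so $S$ ranges over all subsets,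 including the empty set). *)

theory Defs
  imports "HOL-Analysis.Analysis"
begin

(* Vectors indexed by a finite set I are the extensional functions in I \<rightarrow>\<^sub>E UNIV
   (value undefined outside I), the points of the product measure Pi\<^sub>M I.
   M = {1..m} and N = {1..n}; a point (x, y) has entries x (i, j) and y i. *)
definition coord_space ::
    "nat \<Rightarrow> nat \<Rightarrow> ((nat \<times> nat \<Rightarrow> real) \<times> (nat \<Rightarrow> real)) set" where
  "coord_space m n = ({1..m} \<times> {1..n} \<rightarrow>\<^sub>E UNIV) \<times> ({1..m} \<rightarrow>\<^sub>E UNIV)"

definition strong_relaxation ::
    "nat \<Rightarrow> nat \<Rightarrow> ((nat \<times> nat \<Rightarrow> real) \<times> (nat \<Rightarrow> real)) set" where
  "strong_relaxation m n = {(x, y) \<in> coord_space m n.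
     (\<forall>i\<in>{1..m}. \<forall>j\<in>{1..n}. 0 \<le> x (i, j) \<and> x (i, j) \<le> y i) \<and>
     (\<forall>i\<in>{1..m}. y i \<le> 1)}"

definition demand_space ::
    "nat \<Rightarrow> nat \<Rightarrow> ((nat \<times> nat \<Rightarrow> real) \<times> (nat \<Rightarrow> real)) set" where
  "demand_space m n = {(x, y) \<in> coord_space m n.
     \<forall>j\<in>{1..n}. (\<Sum>i\<in>{1..m}. x (i, j)) = 1}"

(* Deletes the variables x (m, j), j \<in> N. *)
definition delete_last_row ::
    "nat \<Rightarrow> nat \<Rightarrow> (nat \<times> nat \<Rightarrow> real) \<times> (nat \<Rightarrow> real) \<Rightarrow>
       (nat \<times> nat \<Rightarrow> real) \<times> (nat \<Rightarrow> real)" where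
  "delete_last_row m n = (\<lambda>(x, y). (restrict x ({1..<m} \<times> {1..n}), y))"

(* Lebesgue measure in dimension d = (m - 1) * n + m. The product measures carry the Borel
   sigma-algebra; the completion adds the remaining Lebesgue measurable sets. *)
definition reduced_lebesgue ::
    "nat \<Rightarrow> nat \<Rightarrow> ((nat \<times> nat \<Rightarrow> real) \<times> (nat \<Rightarrow> real)) measure" where
  "reduced_lebesgue m n = completion
     (Pi\<^sub>M ({1..<m} \<times> {1..n}) (\<lambda>_. lborel) \<Otimes>\<^sub>M Pi\<^sub>M {1..m} (\<lambda>_. lborel))"

(* Intended for bounded sets K \<subseteq> demand_space m n: the value is a real number, and the
   library's real-valued measure is 0 on sets of infinite measure. *)
definition Vol ::
    "nat \<Rightarrow> nat \<Rightarrow> ((nat \<times> nat \<Rightarrow> real) \<times> (nat \<Rightarrow> real)) set \<Rightarrow> real" where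
  "Vol m n K = measure (reduced_lebesgue m n) (delete_last_row m n ` K)"

definition f_fun :: "nat \<Rightarrow> (nat \<Rightarrow> real) \<Rightarrow> real" where
  "f_fun m y = 1 / fact (m - 1) *
     (\<Sum>S\<in>Pow {1..m}. (-1) ^ card S * (max (1 - (\<Sum>i\<in>S. y i)) 0) ^ (m - 1))"

end

theory Submission imports Defs begin

text \<open>
  After eliminating the last row of \<open>x\<close>, the columns of \<open>x\<close> are independent given \<open>y\<close>: each ranges
  over the slab \<open>{u. 0 \<le> u i \<le> y i, 0 \<le> 1 - sum u \<le> y m}\<close> in dimension \<open>m - 1\<close>, so by Fubini the volume
  is the integral over \<open>y\<close> of the \<open>n\<close>-th power of the volume of this slab. If \<open>F (k + 1)\<close> is an
  antiderivative of \<open>F k\<close> for all \<open>k\<close>, integrating \<open>F 0 (t - sum u)\<close> one coordinate at a time over a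
  box in dimension \<open>k\<close> gives the alternating sum of \<open>F k (t - s)\<close> over the subset sums \<open>s\<close> of the
  side lengths. Taking for \<open>F 0\<close> the indicator function of \<open>{0..y m}\<close> yields \<open>f_fun m y\<close>. For \<open>m = 2\<close>
  the remaining integrand is \<open>(y 1 + y 2 - 1)\<close> truncated at 0, to the power \<open>n\<close>, and the same formula
  on the unit square evaluates its integral.
\<close>

section \<open>Alternating subset sums and integration over a box\<close>

text \<open>Subsets of \<open>insert i I\<close> either avoid \<open>i\<close> or arise from a
  subset of \<open>I\<close> by adding \<open>i\<close>, which flips the sign. Pairing the two kinds
  produces the differences that integration in coordinate \<open>i\<close> yields.\<close>

lemma sum_Pow_insert_alternating:
  fixes g :: "real \<Rightarrow> real" and y :: "'a \<Rightarrow> real"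
  assumes "finite I" "i \<notin> I"
  shows "(\<Sum>S\<in>Pow (insert i I). (-1) ^ card S * g (\<Sum>j\<in>S. y j)) =
    (\<Sum>S\<in>Pow I. (-1) ^ card S * (g (\<Sum>j\<in>S. y j) - g (y i + (\<Sum>j\<in>S. y j))))"
proof -
  have card_ins: "card (insert i S) = Suc (card S)" and sum_ins: "sum y (insert i S) = y i + sum y S"
    if "S \<in> Pow I" for S
  proof -
    have "finite S" "i \<notin> S" using that assms finite_subset[of S I] by auto
    then show "card (insert i S) = Suc (card S)" "sum y (insert i S) = y i + sum y S" by auto
  qed
  have inj: "inj_on (insert i) (Pow I)"
    using assms(2) by (intro inj_on_inverseI[of _ "\<lambda>S. S - {i}"]) auto
  have "(\<Sum>S\<in>Pow (insert i I). (-1) ^ card S * g (\<Sum>j\<in>S. y j)) =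
      (\<Sum>S\<in>Pow I. (-1) ^ card S * g (\<Sum>j\<in>S. y j)) +
      (\<Sum>S\<in>insert i ` Pow I. (-1) ^ card S * g (\<Sum>j\<in>S. y j))"
    unfolding Pow_insert using assms by (intro sum.union_disjoint) auto
  also have "(\<Sum>S\<in>insert i ` Pow I. (-1) ^ card S * g (\<Sum>j\<in>S. y j)) =
      (\<Sum>S\<in>Pow I. - ((-1) ^ card S * g (y i + (\<Sum>j\<in>S. y j))))"
    unfolding sum.reindex[OF inj] by (intro sum.cong) (auto simp: card_ins sum_ins)
  finally show ?thesis
    by (simp add: sum_negf sum_subtractf right_diff_distrib)
qed

text \<open>Each subset sum only shifts the argument of \<open>F k\<close>, so integration turns
  every term into a difference of values of \<open>F (Suc k)\<close> at distance \<open>y i\<close>.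
  By \<open>sum_Pow_insert_alternating\<close> these differences merge into one sum over the larger
  index set.\<close>

lemma has_integral_box_step:
  fixes F :: "nat \<Rightarrow> real \<Rightarrow> real" and y :: "'a \<Rightarrow> real"
  assumes int: "\<And>k c b. 0 \<le> b \<Longrightarrow>
      ((\<lambda>s. F k (c - s)) has_integral (F (Suc k) c - F (Suc k) (c - b))) {0..b}"
    and "finite I" "i \<notin> I" "0 \<le> y i"
  shows "((\<lambda>s. \<Sum>S\<in>Pow I. (-1) ^ card S * F k (t - s - (\<Sum>j\<in>S. y j))) has_integral
    (\<Sum>S\<in>Pow (insert i I). (-1) ^ card S * F (Suc k) (t - (\<Sum>j\<in>S. y j)))) {0..y i}"
proof -
  have "((\<lambda>s. \<Sum>S\<in>Pow I. (-1) ^ card S * F k ((t - (\<Sum>j\<in>S. y j)) - s)) has_integral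
    (\<Sum>S\<in>Pow I. (-1) ^ card S * (F (Suc k) (t - (\<Sum>j\<in>S. y j)) -
        F (Suc k) (t - (\<Sum>j\<in>S. y j) - y i)))) {0..y i}"
    using assms by (intro has_integral_sum has_integral_mult_right int) auto
  moreover have "(\<lambda>s. \<Sum>S\<in>Pow I. (-1) ^ card S * F k ((t - (\<Sum>j\<in>S. y j)) - s)) =
      (\<lambda>s. \<Sum>S\<in>Pow I. (-1) ^ card S * F k (t - s - (\<Sum>j\<in>S. y j)))"
    by (intro ext sum.cong refl) (simp add: algebra_simps)
  moreover have "(\<Sum>S\<in>Pow I. (-1) ^ card S * (F (Suc k) (t - (\<Sum>j\<in>S. y j)) -
        F (Suc k) (t - (\<Sum>j\<in>S. y j) - y i))) =
      (\<Sum>S\<in>Pow (insert i I). (-1) ^ card S * F (Suc k) (t - (\<Sum>j\<in>S. y j)))"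
    unfolding sum_Pow_insert_alternating[OF assms(2,3), of "\<lambda>v. F (Suc k) (t - v)" y]
    by (simp only: diff_diff_eq add.commute)
  ultimately show ?thesis by simp
qed

text \<open>Induction on \<open>I\<close>: fixing the new coordinate at \<open>s\<close> leaves the
  same problem with \<open>t - s\<close> in place of \<open>t\<close>, so the claim is proved for
  all \<open>t\<close> at once. Nonnegativity is carried along because it allows the passage from
  gauge integrals to nonnegative Lebesgue integrals.\<close>

lemma nn_integral_box:
  fixes F :: "nat \<Rightarrow> real \<Rightarrow> real" and y :: "'a \<Rightarrow> real"
  assumes int: "\<And>k c b. 0 \<le> b \<Longrightarrow>
      ((\<lambda>s. F k (c - s)) has_integral (F (Suc k) c - F (Suc k) (c - b))) {0..b}"
    and meas[measurable]: "\<And>k. F k \<in> borel_measurable borel"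
    and nonneg: "\<And>s. 0 \<le> F 0 s"
    and "finite I" "\<And>i. i \<in> I \<Longrightarrow> 0 \<le> y i"
  shows "0 \<le> (\<Sum>S\<in>Pow I. (-1) ^ card S * F (card I) (t - (\<Sum>j\<in>S. y j)))"
    and "(\<integral>\<^sup>+u. (\<Prod>i\<in>I. indicator {0..y i} (u i)) * ennreal (F 0 (t - (\<Sum>i\<in>I. u i)))
        \<partial>Pi\<^sub>M I (\<lambda>_. lborel)) =
      ennreal (\<Sum>S\<in>Pow I. (-1) ^ card S * F (card I) (t - (\<Sum>j\<in>S. y j)))"
proof -
  interpret product_sigma_finite "\<lambda>_::'a. lborel :: real measure" ..
  have "(\<forall>t. 0 \<le> (\<Sum>S\<in>Pow I. (-1) ^ card S * F (card I) (t - (\<Sum>j\<in>S. y j)))) \<and>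
    (\<forall>t. (\<integral>\<^sup>+u. (\<Prod>i\<in>I. indicator {0..y i} (u i)) * ennreal (F 0 (t - (\<Sum>i\<in>I. u i)))
        \<partial>Pi\<^sub>M I (\<lambda>_. lborel)) =
      ennreal (\<Sum>S\<in>Pow I. (-1) ^ card S * F (card I) (t - (\<Sum>j\<in>S. y j))))"
    using assms(4,5)
  proof (induction I rule: finite_induct)
    case empty
    \<comment> \<open>Over the empty index set the product measure is a unit point mass, and
      \<open>S = {}\<close> contributes \<open>F 0 t\<close>.\<close>
    then show ?case using nonneg by (simp add: nn_integral_empty emeasure_PiM_empty space_PiM PiM_empty)
  next
    case (insert i I)
    let ?G = "\<lambda>t. \<Sum>S\<in>Pow I. (-1) ^ card S * F (card I) (t - (\<Sum>j\<in>S. y j))"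
    let ?H = "\<lambda>t. \<Sum>S\<in>Pow (insert i I).
      (-1) ^ card S * F (card (insert i I)) (t - (\<Sum>j\<in>S. y j))"
    have G_nonneg: "0 \<le> ?G t" and
      IH: "(\<integral>\<^sup>+u. (\<Prod>i\<in>I. indicator {0..y i} (u i)) * ennreal (F 0 (t - (\<Sum>i\<in>I. u i)))
        \<partial>Pi\<^sub>M I (\<lambda>_. lborel)) = ennreal (?G t)" for t
      using insert by auto
    have yi: "0 \<le> y i" using insert by auto
    have H: "((\<lambda>s. ?G (t - s)) has_integral ?H t) {0..y i}" for t
      unfolding card_insert_disjoint[OF insert(1,2)]
      by (rule has_integral_box_step[of F I i y, OF int insert(1,2) yi])
    have H_nonneg: "0 \<le> ?H t" for t
      by (rule has_integral_nonneg[OF H]) (rule G_nonneg)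
    have "(\<integral>\<^sup>+u. (\<Prod>j\<in>insert i I. indicator {0..y j} (u j)) *
        ennreal (F 0 (t - (\<Sum>j\<in>insert i I. u j))) \<partial>Pi\<^sub>M (insert i I) (\<lambda>_. lborel)) =
      ennreal (?H t)" for t
    proof -
      have "(\<integral>\<^sup>+u. (\<Prod>j\<in>insert i I. indicator {0..y j} (u j)) *
          ennreal (F 0 (t - (\<Sum>j\<in>insert i I. u j))) \<partial>Pi\<^sub>M (insert i I) (\<lambda>_. lborel)) =
        (\<integral>\<^sup>+s. (\<integral>\<^sup>+u. (\<Prod>j\<in>insert i I. indicator {0..y j} ((u(i := s)) j)) *
          ennreal (F 0 (t - (\<Sum>j\<in>insert i I. (u(i := s)) j))) \<partial>Pi\<^sub>M I (\<lambda>_. lborel)) \<partial>lborel)"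
        using insert(1,2) by (intro product_nn_integral_insert_rev) auto
      also have "\<dots> = (\<integral>\<^sup>+s. (\<integral>\<^sup>+u. indicator {0..y i} s * ((\<Prod>j\<in>I. indicator {0..y j} (u j)) *
          ennreal (F 0 ((t - s) - (\<Sum>j\<in>I. u j)))) \<partial>Pi\<^sub>M I (\<lambda>_. lborel)) \<partial>lborel)"
      proof (intro nn_integral_cong, goal_cases)
        case (1 s u)
        have "(\<Prod>j\<in>I. indicator {0..y j} ((u(i := s)) j)) =
            (\<Prod>j\<in>I. indicator {0..y j} (u j) :: ennreal)"
          "(\<Sum>j\<in>I. (u(i := s)) j) = (\<Sum>j\<in>I. u j)"
          using insert(2) by (auto intro!: prod.cong sum.cong)
        then show ?case using insert(1,2) by (simp add: mult.assoc diff_diff_eq del: fun_upd_apply) simp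
      qed
      also have "\<dots> = (\<integral>\<^sup>+s. indicator {0..y i} s * ennreal (?G (t - s)) \<partial>lborel)"
        by (subst nn_integral_cmult) (simp_all add: IH)
      also have "\<dots> = (\<integral>\<^sup>+s. ennreal (indicator {0..y i} s * ?G (t - s)) \<partial>lborel)"
        by (intro nn_integral_cong) (simp add: indicator_def)
      \<comment> \<open>The gauge integral \<open>H\<close> becomes a Lebesgue integral here, since
        \<open>?G\<close> is nonnegative.\<close>
      also have "\<dots> = ennreal (?H t)"
        using G_nonneg H by (intro nn_integral_has_integral_lebesgue) auto
      finally show ?thesis .
    qed
    with H_nonneg show ?case by blast
  qed
  then show "0 \<le> (\<Sum>S\<in>Pow I. (-1) ^ card S * F (card I) (t - (\<Sum>j\<in>S. y j)))"
    and "(\<integral>\<^sup>+u. (\<Prod>i\<in>I. indicator {0..y i} (u i)) * ennreal (F 0 (t - (\<Sum>i\<in>I. u i)))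
        \<partial>Pi\<^sub>M I (\<lambda>_. lborel)) =
      ennreal (\<Sum>S\<in>Pow I. (-1) ^ card S * F (card I) (t - (\<Sum>j\<in>S. y j)))"
    by blast+
qed

section \<open>Integrals of truncated powers\<close>

text \<open>The value \<open>g 0\<close> is left open so that \<open>k = 0\<close> covers the step functions with either value at 0;
  \<open>max s 0 ^ 0\<close> would be 1 for negative \<open>s\<close>.\<close>

lemma has_real_derivative_max_power:
  fixes g :: "real \<Rightarrow> real"
  assumes g: "\<And>s. s \<noteq> 0 \<Longrightarrow> g s = (if 0 < s then s ^ k else 0)" and "t \<noteq> 0"
  shows "((\<lambda>s. max s 0 ^ Suc k) has_real_derivative (real (Suc k) * g t)) (at t)"
proof (cases "0 < t")
  case True
  have "((\<lambda>s. s ^ Suc k) has_real_derivative (real (Suc k) * g t)) (at t)"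
    using DERIV_pow[of "Suc k" t] True g by simp
  then show ?thesis
    by (rule has_field_derivative_transform_within_open[where S="{0<..}"])
       (use True in auto)
next
  case False
  have "((\<lambda>s. 0) has_real_derivative (real (Suc k) * g t)) (at t)"
    using False assms by auto
  then show ?thesis
    by (rule has_field_derivative_transform_within_open[where S="{..<0}"])
       (use False assms in auto)
qed

text \<open>\<open>?P\<close> is continuous everywhere and an antiderivative away from the corner
  \<open>s = c\<close>, where \<open>g\<close> is evaluated at 0. The fundamental theorem of
  calculus tolerates this one exceptional point.\<close>

lemma has_integral_max_power:
  fixes g :: "real \<Rightarrow> real"
  assumes g: "\<And>s. s \<noteq> 0 \<Longrightarrow> g s = (if 0 < s then s ^ k else 0)" and "0 \<le> b"
  shows "((\<lambda>s. g (c - s)) has_integral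
    (max c 0 ^ Suc k - max (c - b) 0 ^ Suc k) / real (Suc k)) {0..b}"
proof -
  let ?P = "\<lambda>s. - (max (c - s) 0 ^ Suc k) / real (Suc k)"
  have "(?P has_vector_derivative g (c - s)) (at s)" if "s \<noteq> c" for s
  proof -
    have "((\<lambda>s. max (c - s) 0 ^ Suc k) has_real_derivative (real (Suc k) * g (c - s) * (- 1))) (at s)"
      by (rule DERIV_chain2[where f="\<lambda>s. max s 0 ^ Suc k", OF has_real_derivative_max_power[OF g]])
         (use that in \<open>auto intro!: derivative_eq_intros\<close>)
    from DERIV_cdivide[OF DERIV_minus[OF this], of "real (Suc k)"] show ?thesis
      by (simp add: has_real_derivative_iff_has_vector_derivative del: of_nat_Suc)
  qed
  then have "((\<lambda>s. g (c - s)) has_integral (?P b - ?P 0)) {0..b}"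
    using assms(2) by (intro fundamental_theorem_of_calculus_interior_strong[of "{c}"])
      (auto intro!: continuous_intros)
  then show ?thesis by (simp add: diff_divide_distrib)
qed

text \<open>The same argument for a truncated power that grows with the integration variable. It
  serves the case \<open>m = 2\<close>, where the functions to be integrated are supported on
  negative arguments.\<close>

lemma has_integral_max_power_reflected:
  fixes g :: "real \<Rightarrow> real"
  assumes g: "\<And>s. s \<noteq> 0 \<Longrightarrow> g s = (if 0 < s then s ^ k else 0)" and "0 \<le> b"
  shows "((\<lambda>s. g (s - c)) has_integral
    (max (b - c) 0 ^ Suc k - max (- c) 0 ^ Suc k) / real (Suc k)) {0..b}"
proof -
  let ?P = "\<lambda>s. max (s - c) 0 ^ Suc k / real (Suc k)"
  have "(?P has_vector_derivative g (s - c)) (at s)" if "s \<noteq> c" for s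
  proof -
    have "((\<lambda>s. max (s - c) 0 ^ Suc k) has_real_derivative (real (Suc k) * g (s - c) * 1)) (at s)"
      by (rule DERIV_chain2[where f="\<lambda>s. max s 0 ^ Suc k", OF has_real_derivative_max_power[OF g]])
         (use that in \<open>auto intro!: derivative_eq_intros\<close>)
    from DERIV_cdivide[OF this, of "real (Suc k)"] show ?thesis
      by (simp add: has_real_derivative_iff_has_vector_derivative del: of_nat_Suc)
  qed
  then have "((\<lambda>s. g (s - c)) has_integral (?P b - ?P 0)) {0..b}"
    using assms(2) by (intro fundamental_theorem_of_calculus_interior_strong[of "{c}"])
      (auto intro!: continuous_intros)
  then show ?thesis by (simp add: diff_divide_distrib)
qed

section \<open>Independence of the columns of a matrix\<close>

text \<open>Different columns use disjoint blocks of coordinates, so Tonelli splits off one column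
  at a time, each contributing the same factor.\<close>

lemma nn_integral_PiM_columns:
  fixes A :: "'a set" and J :: "'b set"
  assumes "sigma_finite_measure L" "finite A" "finite J"
    and g[measurable]: "g \<in> borel_measurable (Pi\<^sub>M A (\<lambda>_. L))"
  shows "(\<integral>\<^sup>+x. (\<Prod>j\<in>J. g (\<lambda>i\<in>A. x (i, j))) \<partial>Pi\<^sub>M (A \<times> J) (\<lambda>_. L)) =
    (\<integral>\<^sup>+u. g u \<partial>Pi\<^sub>M A (\<lambda>_. L)) ^ card J"
  using assms(3)
proof (induction J rule: finite_induct)
  case empty
  interpret product_sigma_finite "\<lambda>_::'a \<times> 'b. L" using assms(1) by (simp add: product_sigma_finite_def)
  show ?case by (simp add: nn_integral_empty emeasure_PiM_empty space_PiM PiM_empty)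
next
  case (insert k J)
  interpret product_sigma_finite "\<lambda>_::'a \<times> 'b. L" using assms(1) by (simp add: product_sigma_finite_def)
  interpret A: product_sigma_finite "\<lambda>_::'a. L" using assms(1) by (simp add: product_sigma_finite_def)
  let ?col = "\<lambda>j x. \<lambda>i\<in>A. x (i, j)"
  have col[measurable]: "?col j \<in> Pi\<^sub>M B (\<lambda>_. L) \<rightarrow>\<^sub>M Pi\<^sub>M A (\<lambda>_. L)" if "A \<times> {j} \<subseteq> B" for j B
    using that by (intro measurable_restrict measurable_component_singleton) auto
  \<comment> \<open>Relabelling \<open>(i, k)\<close> as \<open>i\<close> carries the product
    measure of one column to the product measure over \<open>A\<close>: preimages of boxes are boxes
    with the same sides, and boxes determine a product measure.\<close>
  have distr: "distr (Pi\<^sub>M (A \<times> {k}) (\<lambda>_. L)) (Pi\<^sub>M A (\<lambda>_. L)) (?col k) = Pi\<^sub>M A (\<lambda>_. L)"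
  proof (rule A.PiM_eqI)
    fix B assume B: "\<And>i. i \<in> A \<Longrightarrow> B i \<in> sets L"
    have B_space: "b \<in> space L" if "i \<in> A" "b \<in> B i" for i b
      using B that sets.sets_into_space by blast
    have "?col k -` Pi\<^sub>E A B \<inter> space (Pi\<^sub>M (A \<times> {k}) (\<lambda>_. L)) = Pi\<^sub>E (A \<times> {k}) (B \<circ> fst)"
      by (auto simp: space_PiM PiE_iff B_space)
    moreover have "(\<Prod>p\<in>A \<times> {k}. emeasure L ((B \<circ> fst) p)) = (\<Prod>i\<in>A. emeasure L (B i))"
      by (rule prod.reindex_bij_witness[of _ "\<lambda>i. (i, k)" fst]) auto
    moreover have "emeasure (Pi\<^sub>M (A \<times> {k}) (\<lambda>_. L)) (Pi\<^sub>E (A \<times> {k}) (B \<circ> fst)) =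
        (\<Prod>p\<in>A \<times> {k}. emeasure L ((B \<circ> fst) p))"
      using B assms(2) by (intro emeasure_PiM) auto
    ultimately show "emeasure (distr (Pi\<^sub>M (A \<times> {k}) (\<lambda>_. L)) (Pi\<^sub>M A (\<lambda>_. L)) (?col k)) (Pi\<^sub>E A B) =
        (\<Prod>i\<in>A. emeasure L (B i))"
      using B assms(2) by (subst emeasure_distr) auto
  qed (use assms in auto)
  have inner: "(\<integral>\<^sup>+x. g (?col k x) \<partial>Pi\<^sub>M (A \<times> {k}) (\<lambda>_. L)) = (\<integral>\<^sup>+u. g u \<partial>Pi\<^sub>M A (\<lambda>_. L))"
    using nn_integral_distr[of "?col k" "Pi\<^sub>M (A \<times> {k}) (\<lambda>_. L)" "Pi\<^sub>M A (\<lambda>_. L)" g]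
    unfolding distr by (simp add: g)
  have "A \<times> insert k J = A \<times> J \<union> A \<times> {k}" by auto
  then have "(\<integral>\<^sup>+x. (\<Prod>j\<in>insert k J. g (?col j x)) \<partial>Pi\<^sub>M (A \<times> insert k J) (\<lambda>_. L)) =
    (\<integral>\<^sup>+x. (\<Prod>j\<in>insert k J. g (?col j x)) \<partial>Pi\<^sub>M (A \<times> J \<union> A \<times> {k}) (\<lambda>_. L))"
    by simp
  also have "\<dots> = (\<integral>\<^sup>+x. (\<integral>\<^sup>+z. (\<Prod>j\<in>insert k J. g (?col j (merge (A \<times> J) (A \<times> {k}) (x, z))))
      \<partial>Pi\<^sub>M (A \<times> {k}) (\<lambda>_. L)) \<partial>Pi\<^sub>M (A \<times> J) (\<lambda>_. L))"
    using insert(1,2) assms(2)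
    by (intro product_nn_integral_fold borel_measurable_prod_ennreal measurable_compose[OF col g]) auto
  \<comment> \<open>After merging, the columns in \<open>J\<close> depend on \<open>x\<close> only
    and column \<open>k\<close> on \<open>z\<close> only.\<close>
  also have "\<dots> = (\<integral>\<^sup>+x. (\<integral>\<^sup>+z. (\<Prod>j\<in>J. g (?col j x)) * g (?col k z)
      \<partial>Pi\<^sub>M (A \<times> {k}) (\<lambda>_. L)) \<partial>Pi\<^sub>M (A \<times> J) (\<lambda>_. L))"
  proof (intro nn_integral_cong, goal_cases)
    case (1 x z)
    have "?col k (merge (A \<times> J) (A \<times> {k}) (x, z)) = ?col k z"
      using insert(2) by (auto simp: merge_def)
    moreover have "?col j (merge (A \<times> J) (A \<times> {k}) (x, z)) = ?col j x" if "j \<in> J" for j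
      using that by (auto simp: merge_def)
    ultimately show ?case using insert(1,2) by (simp add: mult.commute)
  qed
  also have "\<dots> = (\<integral>\<^sup>+x. (\<Prod>j\<in>J. g (?col j x)) * (\<integral>\<^sup>+u. g u \<partial>Pi\<^sub>M A (\<lambda>_. L))
      \<partial>Pi\<^sub>M (A \<times> J) (\<lambda>_. L))"
    by (subst nn_integral_cmult) (auto simp: inner)
  also have "\<dots> = (\<integral>\<^sup>+x. (\<Prod>j\<in>J. g (?col j x)) \<partial>Pi\<^sub>M (A \<times> J) (\<lambda>_. L)) *
      (\<integral>\<^sup>+u. g u \<partial>Pi\<^sub>M A (\<lambda>_. L))"
    by (intro nn_integral_multc borel_measurable_prod_ennreal measurable_compose[OF col g]) auto
  finally show ?case
    unfolding insert.IH card_insert_disjoint[OF insert(1,2)] power_Suc2 .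
qed

section \<open>The volume of the slab of a single column\<close>

text \<open>The box formula at \<open>t = 1\<close> applies to the indicator of
  \<open>{0..y m}\<close>, whose iterated antiderivatives are differences of two truncated powers.
  The shift by \<open>y m\<close> between them makes \<open>y m\<close> act as one more side length,
  which turns subsets of \<open>{1..<m}\<close> into subsets of \<open>{1..m}\<close>.\<close>

lemma nn_integral_column:
  fixes y :: "nat \<Rightarrow> real"
  assumes "2 \<le> m" and y: "\<And>i. i \<in> {1..m} \<Longrightarrow> 0 \<le> y i"
  shows "0 \<le> f_fun m y"
    and "(\<integral>\<^sup>+u. (\<Prod>i\<in>{1..<m}. indicator {0..y i} (u i)) *
        ennreal (indicator {0..y m} (1 - (\<Sum>i\<in>{1..<m}. u i))) \<partial>Pi\<^sub>M {1..<m} (\<lambda>_. lborel)) =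
      ennreal (f_fun m y)"
proof -
  \<comment> \<open>Non-strict in the first test and strict in the second, so that
    \<open>F 0\<close> is the indicator of the closed interval; for positive \<open>k\<close> both
    tests give ordinary truncated powers.\<close>
  define F :: "nat \<Rightarrow> real \<Rightarrow> real" where "F k s =
    ((if 0 \<le> s then s ^ k else 0) - (if 0 < s - y m then (s - y m) ^ k else 0)) / fact k" for k s
  have F_Suc: "F (Suc k) s = (max s 0 ^ Suc k - max (s - y m) 0 ^ Suc k) / fact (Suc k)" for k s
    by (simp add: F_def max_def)
  have F_0: "F 0 s = indicator {0..y m} s" for s
    using y[of m] assms(1) by (auto simp: F_def indicator_def)
  have int: "((\<lambda>s. F k (c - s)) has_integral (F (Suc k) c - F (Suc k) (c - b))) {0..b}"
    if "0 \<le> b" for k c b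
  proof -
    \<comment> \<open>The two conventions at 0 are both instances of
      \<open>has_integral_max_power\<close>, which prescribes \<open>g\<close> only away from
      0.\<close>
    have "((\<lambda>s. ((if 0 \<le> c - s then (c - s) ^ k else 0) -
        (if 0 < (c - y m) - s then ((c - y m) - s) ^ k else 0)) / fact k) has_integral
      ((max c 0 ^ Suc k - max (c - b) 0 ^ Suc k) / real (Suc k) -
       (max (c - y m) 0 ^ Suc k - max ((c - y m) - b) 0 ^ Suc k) / real (Suc k)) / fact k) {0..b}"
      using that
      by (intro has_integral_divide has_integral_diff
          has_integral_max_power[of "\<lambda>s. if 0 \<le> s then s ^ k else 0"]
          has_integral_max_power[of "\<lambda>s. if 0 < s then s ^ k else 0"]) auto
    moreover have "((max c 0 ^ Suc k - max (c - b) 0 ^ Suc k) / real (Suc k) -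
       (max (c - y m) 0 ^ Suc k - max ((c - y m) - b) 0 ^ Suc k) / real (Suc k)) / fact k =
      F (Suc k) c - F (Suc k) (c - b)"
      unfolding F_Suc fact_Suc cancel_ab_semigroup_add_class.diff_right_commute[of c "y m" b]
      by (simp add: diff_divide_distrib mult.commute
          del: power_Suc of_nat_Suc)
    moreover have "(\<lambda>s. ((if 0 \<le> c - s then (c - s) ^ k else 0) -
        (if 0 < (c - y m) - s then ((c - y m) - s) ^ k else 0)) / fact k) = (\<lambda>s. F k (c - s))"
      unfolding F_def cancel_ab_semigroup_add_class.diff_right_commute[of c "y m"] ..
    ultimately show ?thesis by (simp only:)
  qed
  have meas: "F k \<in> borel_measurable borel" for k
    unfolding F_def by measurable
  have M: "{1..m} = insert m {1..<m}" using assms(1) by auto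
  have "f_fun m y = (\<Sum>S\<in>Pow {1..<m}. (-1) ^ card S *
      (max (1 - (\<Sum>i\<in>S. y i)) 0 ^ (m - 1) - max (1 - (y m + (\<Sum>i\<in>S. y i))) 0 ^ (m - 1))) / fact (m - 1)"
    unfolding f_fun_def M
    by (subst sum_Pow_insert_alternating[where g="\<lambda>v. max (1 - v) 0 ^ (m - 1)"]) auto
  also have "\<dots> = (\<Sum>S\<in>Pow {1..<m}. (-1) ^ card S * F (card {1..<m}) (1 - (\<Sum>i\<in>S. y i)))"
  proof -
    \<comment> \<open>As \<open>2 \<le> m\<close>, the exponent is positive and \<open>F_Suc\<close>
      rewrites \<open>F\<close> in terms of \<open>max\<close>.\<close>
    have "m - 1 = Suc (m - 2)" using assms(1) by simp
    then have "F (card {1..<m}) s = (max s 0 ^ (m - 1) - max (s - y m) 0 ^ (m - 1)) / fact (m - 1)" for s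
      using F_Suc[of "m - 2"] by simp
    then show ?thesis
      unfolding sum_divide_distrib by (intro sum.cong refl) (simp add: algebra_simps)
  qed
  finally have f: "f_fun m y = (\<Sum>S\<in>Pow {1..<m}. (-1) ^ card S * F (card {1..<m}) (1 - (\<Sum>i\<in>S. y i)))" .
  note box = nn_integral_box[where F=F and I="{1..<m}" and y=y and t=1, OF int meas]
  show "0 \<le> f_fun m y"
    unfolding f using y by (intro box) (auto simp: F_0)
  show "(\<integral>\<^sup>+u. (\<Prod>i\<in>{1..<m}. indicator {0..y i} (u i)) *
        ennreal (indicator {0..y m} (1 - (\<Sum>i\<in>{1..<m}. u i))) \<partial>Pi\<^sub>M {1..<m} (\<lambda>_. lborel)) =
      ennreal (f_fun m y)"
    unfolding f F_0[symmetric] using y by (intro box) (auto simp: F_0)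
qed

section \<open>The projected polytope\<close>

text \<open>The demand constraints determine the deleted row, so its bounds become conditions on the
  remaining entries. For fixed \<open>y\<close> the conditions on \<open>x\<close> separate by
  column.\<close>

lemma delete_last_row_image:
  assumes "2 \<le> m" "1 \<le> n"
  shows "delete_last_row m n ` (strong_relaxation m n \<inter> demand_space m n) =
    {(x, y). x \<in> {1..<m} \<times> {1..n} \<rightarrow>\<^sub>E UNIV \<and> y \<in> {1..m} \<rightarrow>\<^sub>E {0..1} \<and>
      (\<forall>j\<in>{1..n}. (\<forall>i\<in>{1..<m}. x (i, j) \<in> {0..y i}) \<and>
        1 - (\<Sum>i\<in>{1..<m}. x (i, j)) \<in> {0..y m})}" (is "?L = ?R")
proof (intro equalityI subsetI)
  have M: "{1..m} = insert m {1..<m}" using assms(1) by auto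
  fix p assume "p \<in> ?L"
  then obtain x y where p: "p = (restrict x ({1..<m} \<times> {1..n}), y)"
    and y: "y \<in> {1..m} \<rightarrow>\<^sub>E UNIV" "\<And>i. i \<in> {1..m} \<Longrightarrow> y i \<le> 1"
    and x: "\<And>i j. i \<in> {1..m} \<Longrightarrow> j \<in> {1..n} \<Longrightarrow> 0 \<le> x (i, j)"
      "\<And>i j. i \<in> {1..m} \<Longrightarrow> j \<in> {1..n} \<Longrightarrow> x (i, j) \<le> y i"
    and s: "\<And>j. j \<in> {1..n} \<Longrightarrow> (\<Sum>i\<in>{1..m}. x (i, j)) = 1"
    by (auto simp: strong_relaxation_def demand_space_def delete_last_row_def coord_space_def)
  \<comment> \<open>The relaxation bounds \<open>y\<close> below only through \<open>x\<close>;
    since \<open>1 \<le> n\<close>, column 1 exists and forces this.\<close>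
  have "0 \<le> y i" if "i \<in> {1..m}" for i
    using x[OF that, of 1] assms(2) by auto
  moreover have "1 - (\<Sum>i\<in>{1..<m}. x (i, j)) = x (m, j)" if "j \<in> {1..n}" for j
    using s[OF that] unfolding M by simp
  then have "1 - (\<Sum>i\<in>{1..<m}. x (i, j)) \<in> {0..y m}" if "j \<in> {1..n}" for j
    using that x[of m j] assms(1) by simp
  ultimately show "p \<in> ?R"
    using x y unfolding p by (auto simp: PiE_iff)
next
  have M: "{1..m} = insert m {1..<m}" using assms(1) by auto
  fix p assume "p \<in> ?R"
  then obtain x y where p: "p = (x, y)"
    and x: "x \<in> {1..<m} \<times> {1..n} \<rightarrow>\<^sub>E UNIV" and y: "y \<in> {1..m} \<rightarrow>\<^sub>E {0..1}"
    and xb: "\<And>i j. i \<in> {1..<m} \<Longrightarrow> j \<in> {1..n} \<Longrightarrow> x (i, j) \<in> {0..y i}"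
    and xm: "\<And>j. j \<in> {1..n} \<Longrightarrow> 1 - (\<Sum>i\<in>{1..<m}. x (i, j)) \<in> {0..y m}"
    by auto
  \<comment> \<open>The preimage refills the last row from the demand constraints.\<close>
  define x' where "x' = (\<lambda>(i, j)\<in>{1..m} \<times> {1..n}.
    if i = m then 1 - (\<Sum>i\<in>{1..<m}. x (i, j)) else x (i, j))"
  have x'_m: "x' (m, j) = 1 - (\<Sum>i\<in>{1..<m}. x (i, j))" if "j \<in> {1..n}" for j
    using that assms(1) by (simp add: x'_def)
  have x'_less: "x' (i, j) = x (i, j)" if "i \<in> {1..<m}" "j \<in> {1..n}" for i j
    using that by (simp add: x'_def)
  have "(x', y) \<in> coord_space m n"
    using y by (auto simp: coord_space_def x'_def PiE_iff)
  moreover have "x' (i, j) \<in> {0..y i}" if "i \<in> {1..m}" "j \<in> {1..n}" for i j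
    using that xb xm x'_m x'_less unfolding M by auto
  moreover have "(\<Sum>i\<in>{1..m}. x' (i, j)) = 1" if "j \<in> {1..n}" for j
    unfolding M using that by (simp add: x'_m x'_less)
  ultimately have "(x', y) \<in> strong_relaxation m n \<inter> demand_space m n"
    using y by (auto simp: strong_relaxation_def demand_space_def PiE_iff)
  moreover have "delete_last_row m n (x', y) = p"
    using x x'_less by (auto simp: p delete_last_row_def PiE_iff extensional_def restrict_def fun_eq_iff)
  ultimately show "p \<in> ?L" by (metis imageI)
qed

section \<open>The volume as an integral over \<open>y\<close>\<close>

lemma f_fun_measurable [measurable]: "f_fun m \<in> borel_measurable (Pi\<^sub>M {1..m} (\<lambda>_. lborel))"
proof -
  have "(\<lambda>y. y i) \<in> borel_measurable (Pi\<^sub>M {1..m} (\<lambda>_. lborel))" if "i \<in> {1..m}" for i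
    using measurable_component_singleton[OF that, of "\<lambda>_. lborel"] by simp
  then show ?thesis
    unfolding f_fun_def[abs_def]
    by (intro borel_measurable_times borel_measurable_sum borel_measurable_power
        borel_measurable_max borel_measurable_diff borel_measurable_const) blast
qed

lemma Vol_eq_integral:
  assumes "2 \<le> m" "1 \<le> n"
  shows "Vol m n (strong_relaxation m n \<inter> demand_space m n) =
    (LINT y : {1..m} \<rightarrow>\<^sub>E {0..1} | Pi\<^sub>M {1..m} (\<lambda>_. lborel). f_fun m y ^ n)"
proof -
  let ?A = "{1..<m}" and ?J = "{1..n}" and ?B = "{1..m}"
  let ?X = "Pi\<^sub>M (?A \<times> ?J) (\<lambda>_. lborel) :: (nat \<times> nat \<Rightarrow> real) measure"
  let ?Y = "Pi\<^sub>M ?B (\<lambda>_. lborel) :: (nat \<Rightarrow> real) measure"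
  let ?T = "delete_last_row m n ` (strong_relaxation m n \<inter> demand_space m n)"
  let ?box = "?B \<rightarrow>\<^sub>E {0..1::real}"
  \<comment> \<open>The indicator of the slab for one column, in the product form of
    \<open>nn_integral_column\<close>.\<close>
  define g :: "(nat \<Rightarrow> real) \<Rightarrow> (nat \<Rightarrow> real) \<Rightarrow> ennreal" where
    "g y u = (\<Prod>i\<in>?A. indicator {0..y i} (u i)) * ennreal (indicator {0..y m} (1 - (\<Sum>i\<in>?A. u i)))" for y u
  have meas_g[measurable]: "g y \<in> borel_measurable (Pi\<^sub>M ?A (\<lambda>_. lborel))" for y
    unfolding g_def by measurable
  interpret X: product_sigma_finite "\<lambda>_::nat \<times> nat. lborel :: real measure" ..
  interpret Y: product_sigma_finite "\<lambda>_::nat. lborel :: real measure" ..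
  interpret X: sigma_finite_measure ?X by (rule X.sigma_finite) simp
  interpret Y: sigma_finite_measure ?Y by (rule Y.sigma_finite) simp
  interpret XY: pair_sigma_finite ?X ?Y ..
  have box[measurable]: "?box \<in> sets ?Y"
    by (intro sets_PiM_I_finite) auto
  \<comment> \<open>Finitely many inequalities between measurable functions, so that measurability
    of \<open>?T\<close> can be read off.\<close>
  have T: "?T = {z \<in> space (?X \<Otimes>\<^sub>M ?Y). snd z \<in> ?box \<and>
      (\<forall>j\<in>?J. (\<forall>i\<in>?A. 0 \<le> fst z (i, j) \<and> fst z (i, j) \<le> snd z i) \<and>
        0 \<le> 1 - (\<Sum>i\<in>?A. fst z (i, j)) \<and> 1 - (\<Sum>i\<in>?A. fst z (i, j)) \<le> snd z m)}"
  proof -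
    have "?box \<subseteq> ?B \<rightarrow>\<^sub>E UNIV" by (intro PiE_mono) simp
    then show ?thesis
      unfolding delete_last_row_image[OF assms] space_pair_measure space_PiM space_lborel
        split_beta mem_Times_iff atLeastAtMost_iff space_borel
      by blast
  qed
  have fst_meas: "(\<lambda>z. fst z (i, j)) \<in> borel_measurable (?X \<Otimes>\<^sub>M ?Y)" if "i \<in> ?A" "j \<in> ?J" for i j
    using measurable_compose[OF measurable_fst measurable_component_singleton[of "(i, j)" "?A \<times> ?J" "\<lambda>_. lborel"]] that
    by simp
  have snd_meas: "(\<lambda>z. snd z i) \<in> borel_measurable (?X \<Otimes>\<^sub>M ?Y)" if "i \<in> ?B" for i
    using measurable_compose[OF measurable_snd measurable_component_singleton[of i ?B "\<lambda>_. lborel"]] that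
    by simp
  have T_meas[measurable]: "?T \<in> sets (?X \<Otimes>\<^sub>M ?Y)"
  proof -
    have "{z \<in> space (?X \<Otimes>\<^sub>M ?Y). snd z \<in> ?box} \<in> sets (?X \<Otimes>\<^sub>M ?Y)"
      using measurable_sets[OF measurable_snd box] by (simp add: vimage_def Int_def conj_commute)
    then show ?thesis
      unfolding T using assms(1)
      by (intro sets.sets_Collect_conj sets.sets_Collect_finite_All
          borel_measurable_le borel_measurable_diff borel_measurable_sum borel_measurable_const
          fst_meas snd_meas) auto
  qed
  \<comment> \<open>The indicator factors over the columns. Membership in \<open>space ?X\<close>
    supplies extensionality of \<open>x\<close>, which the right-hand side cannot detect.\<close>
  have ind: "indicator ?T (x, y) = indicator ?box y * (\<Prod>j\<in>?J. g y (\<lambda>i\<in>?A. x (i, j)))"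
    if "x \<in> space ?X" for x y
  proof -
    have "g y (\<lambda>i\<in>?A. x (i, j)) = of_bool ((\<forall>i\<in>?A. x (i, j) \<in> {0..y i}) \<and>
        1 - (\<Sum>i\<in>?A. x (i, j)) \<in> {0..y m})" for j
      unfolding g_def by (auto simp: indicator_def of_bool_def)
    then have "(\<Prod>j\<in>?J. g y (\<lambda>i\<in>?A. x (i, j))) =
      of_bool (\<forall>j\<in>?J. (\<forall>i\<in>?A. x (i, j) \<in> {0..y i}) \<and> 1 - (\<Sum>i\<in>?A. x (i, j)) \<in> {0..y m})"
      by (auto simp: of_bool_def)
    then show ?thesis
      using that unfolding delete_last_row_image[OF assms]
      by (auto simp: indicator_def space_PiM)
  qed
  have f_nonneg: "0 \<le> f_fun m y" and
    column: "(\<integral>\<^sup>+u. g y u \<partial>Pi\<^sub>M ?A (\<lambda>_. lborel)) = ennreal (f_fun m y)" if "y \<in> ?box" for y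
    using nn_integral_column[of m y, OF assms(1)] that unfolding g_def by (auto simp: PiE_iff)
  have "emeasure (?X \<Otimes>\<^sub>M ?Y) ?T = (\<integral>\<^sup>+z. indicator ?T z \<partial>(?X \<Otimes>\<^sub>M ?Y))"
    by (rule nn_integral_indicator[OF T_meas, symmetric])
  also have "\<dots> = (\<integral>\<^sup>+y. (\<integral>\<^sup>+x. indicator ?T (x, y) \<partial>?X) \<partial>?Y)"
    by (intro XY.nn_integral_snd[symmetric] borel_measurable_indicator T_meas)
  also have "\<dots> = (\<integral>\<^sup>+y. (\<integral>\<^sup>+x. indicator ?box y * (\<Prod>j\<in>?J. g y (\<lambda>i\<in>?A. x (i, j))) \<partial>?X) \<partial>?Y)"
    by (intro nn_integral_cong ind)
  also have "\<dots> = (\<integral>\<^sup>+y. indicator ?box y * (\<integral>\<^sup>+u. g y u \<partial>Pi\<^sub>M ?A (\<lambda>_. lborel)) ^ n \<partial>?Y)"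
  proof (intro nn_integral_cong, goal_cases)
    case (1 y)
    have "(\<integral>\<^sup>+x. (\<Prod>j\<in>?J. g y (\<lambda>i\<in>?A. x (i, j))) \<partial>?X) = (\<integral>\<^sup>+u. g y u \<partial>Pi\<^sub>M ?A (\<lambda>_. lborel)) ^ card ?J"
      by (rule nn_integral_PiM_columns[OF lborel.sigma_finite_measure_axioms _ _ meas_g]) simp_all
    then show ?case by (cases "y \<in> ?box") (simp_all)
  qed
  also have "\<dots> = (\<integral>\<^sup>+y. ennreal (indicator ?box y *\<^sub>R f_fun m y ^ n) \<partial>?Y)"
    by (intro nn_integral_cong) (simp add: indicator_def column[unfolded One_nat_def] ennreal_power f_nonneg)
  finally have "emeasure (?X \<Otimes>\<^sub>M ?Y) ?T = (\<integral>\<^sup>+y. ennreal (indicator ?box y *\<^sub>R f_fun m y ^ n) \<partial>?Y)" .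
  \<comment> \<open>Measures and integrals of nonnegative measurable functions are both
    \<open>enn2real\<close> of their extended values, so the preceding identity transfers to the
    reals.\<close>
  moreover have "(LINT y : ?box | ?Y. f_fun m y ^ n) =
      enn2real (\<integral>\<^sup>+y. ennreal (indicator ?box y *\<^sub>R f_fun m y ^ n) \<partial>?Y)"
    unfolding set_lebesgue_integral_def
  proof (intro integral_eq_nn_integral)
    show "(\<lambda>y. indicator ?box y *\<^sub>R f_fun m y ^ n) \<in> borel_measurable ?Y"
      by measurable
    show "AE y in ?Y. 0 \<le> indicator ?box y *\<^sub>R f_fun m y ^ n"
      by (simp add: indicator_def f_nonneg)
  qed
  \<comment> \<open>\<open>?T\<close> lies in the product sigma-algebra, where the completion keeps
    the measure.\<close>
  moreover have "Vol m n (strong_relaxation m n \<inter> demand_space m n) = measure (?X \<Otimes>\<^sub>M ?Y) ?T"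
    unfolding Vol_def reduced_lebesgue_def by (rule measure_completion[OF T_meas])
  ultimately show ?thesis
    by (simp only: measure_def)
qed

section \<open>Evaluation for \<open>m = 2\<close>\<close>

text \<open>The box formula is reused with side lengths 1 and \<open>t = 1\<close>, starting from
  the function whose value at \<open>1 - y 1 - y 2\<close> is the integrand.\<close>

lemma integral_f_fun_2:
  assumes "1 \<le> n"
  shows "(LINT y : {1..2} \<rightarrow>\<^sub>E {0..1} | Pi\<^sub>M {1..2} (\<lambda>_. lborel). f_fun 2 y ^ n) =
    1 / ((real n + 1) * (real n + 2))"
proof -
  let ?M = "Pi\<^sub>M {1..2} (\<lambda>_. lborel) :: (nat \<Rightarrow> real) measure"
  let ?box = "{1..2::nat} \<rightarrow>\<^sub>E {0..1::real}"
  \<comment> \<open>Iterated antiderivatives of \<open>max (- s) 0 ^ n\<close>: each integration in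
    \<open>s\<close> raises the exponent, divides by it and flips the sign.\<close>
  define F :: "nat \<Rightarrow> real \<Rightarrow> real" where
    "F k s = (-1) ^ k * (max (- s) 0 ^ (n + k) * (fact n / fact (n + k)))" for k s
  have M: "{1..2} = {1, 2::nat}" by auto
  have int: "((\<lambda>s. F k (c - s)) has_integral (F (Suc k) c - F (Suc k) (c - b))) {0..b}"
    if "0 \<le> b" for k c b
  proof -
    have "((\<lambda>s. (-1) ^ k * (max (s - c) 0 ^ (n + k) * (fact n / fact (n + k)))) has_integral
      (-1) ^ k * ((max (b - c) 0 ^ Suc (n + k) - max (- c) 0 ^ Suc (n + k)) / real (Suc (n + k)) *
        (fact n / fact (n + k)))) {0..b}"
      \<comment> \<open>\<open>1 \<le> n\<close> keeps the exponent positive, so the power of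
        \<open>max s 0\<close> vanishes for negative \<open>s\<close> even at
        \<open>k = 0\<close>.\<close>
      using that assms by (intro has_integral_mult_right has_integral_mult_left
          has_integral_max_power_reflected[of "\<lambda>s. max s 0 ^ (n + k)"]) auto
    moreover have "(-1) ^ k * ((max (b - c) 0 ^ Suc (n + k) - max (- c) 0 ^ Suc (n + k)) / real (Suc (n + k)) *
        (fact n / fact (n + k))) = F (Suc k) c - F (Suc k) (c - b)"
      unfolding F_def add_Suc_right fact_Suc by (simp add: field_simps del: power_Suc of_nat_Suc) simp
    ultimately show ?thesis by (simp add: F_def)
  qed
  have meas: "F k \<in> borel_measurable borel" for k
    unfolding F_def by measurable
  \<comment> \<open>On the unit square only the term of \<open>S = {1, 2}\<close> can be truncated;
    the other three add up to \<open>y 1 + y 2 - 1\<close>.\<close>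
  have f: "f_fun 2 y = max (y 1 + y 2 - 1) 0" if "y \<in> ?box" for y
  proof -
    have "0 \<le> y 1" "y 1 \<le> 1" "0 \<le> y 2" "y 2 \<le> 1"
      using that by (auto simp: PiE_iff)
    then show ?thesis
      unfolding f_fun_def M by (simp add: Pow_insert max_def)
  qed
  have "(\<integral>\<^sup>+y. ennreal (indicator ?box y *\<^sub>R f_fun 2 y ^ n) \<partial>?M) =
    (\<integral>\<^sup>+u. (\<Prod>i\<in>{1..2}. indicator {0..1} (u i)) * ennreal (F 0 (1 - (\<Sum>i\<in>{1..2}. u i))) \<partial>?M)"
  proof (intro nn_integral_cong, goal_cases)
    case (1 y)
    then have "(\<Prod>i\<in>{1..2}. indicator {0..1} (y i)) = (indicator ?box y :: ennreal)"
      by (auto simp: M indicator_def space_PiM PiE_iff)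
    moreover have "F 0 (1 - (\<Sum>i\<in>{1..2}. y i)) = max (y 1 + y 2 - 1) 0 ^ n"
      unfolding M by (simp add: F_def)
    ultimately show ?case using f[of y] by (simp add: indicator_def)
  qed
  also have "\<dots> = ennreal (\<Sum>S\<in>Pow {1..2::nat}. (-1) ^ card S * F (card {1..2::nat}) (1 - (\<Sum>j\<in>S. 1)))"
    by (intro nn_integral_box int meas) (auto simp: F_def)
  \<comment> \<open>The arguments are 1, 0, 0 and -1, and \<open>F 2\<close> vanishes at 0 and 1, so
    only the full subset contributes.\<close>
  also have "(\<Sum>S\<in>Pow {1..2::nat}. (-1) ^ card S * F (card {1..2::nat}) (1 - (\<Sum>j\<in>S. 1))) =
      1 / ((real n + 1) * (real n + 2))"
  proof -
    have "fact (n + 2) = (real n + 1) * (real n + 2) * fact n"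
      by (simp add: algebra_simps)
    then have "F 2 (- 1) = 1 / ((real n + 1) * (real n + 2))"
      unfolding F_def by simp
    moreover have "F 2 0 = 0" "F 2 1 = 0"
      by (simp_all add: F_def max_def)
    ultimately show ?thesis
      unfolding M by (simp add: Pow_insert flip: numeral_2_eq_2)
  qed
  finally have eq: "(\<integral>\<^sup>+y. ennreal (indicator ?box y *\<^sub>R f_fun 2 y ^ n) \<partial>?M) =
      ennreal (1 / ((real n + 1) * (real n + 2)))" .
  have "(LINT y : ?box | ?M. f_fun 2 y ^ n) =
      enn2real (\<integral>\<^sup>+y. ennreal (indicator ?box y *\<^sub>R f_fun 2 y ^ n) \<partial>?M)"
    unfolding set_lebesgue_integral_def
  proof (intro integral_eq_nn_integral)
    have [measurable]: "?box \<in> sets ?M" by (intro sets_PiM_I_finite) auto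
    show "(\<lambda>y. indicator ?box y *\<^sub>R f_fun 2 y ^ n) \<in> borel_measurable ?M" by measurable
  qed (auto simp: indicator_def f)
  then show ?thesis unfolding eq by simp
qed

theorem theorem1:
  "(\<forall>m n :: nat. m \<ge> 2 \<longrightarrow> n \<ge> 1 \<longrightarrow>
      Vol m n (strong_relaxation m n \<inter> demand_space m n) =
        (LINT y : {1..m} \<rightarrow>\<^sub>E {0..1} | Pi\<^sub>M {1..m} (\<lambda>_. lborel). f_fun m y ^ n)) \<and>
   (\<forall>n :: nat. n \<ge> 1 \<longrightarrow>
      Vol 2 n (strong_relaxation 2 n \<inter> demand_space 2 n) =
        1 / ((real n + 1) * (real n + 2)))"
  using Vol_eq_integral integral_f_fun_2 by auto

end
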